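(* Let $n\ge 1$ and let $S_n$ be the symmetric group on $\{1,\dots,n\}$. The maximal cardinality of a minimal inversion complete subset of $S_n$ is $\lfloor n^2/4\rfloor$.
   Context: For $\sigma\in S_n$, if $1\le i<j\le n$ and $\sigma(i)>\sigma(j)$, the pair $(\sigma(i),\sigma(j))$ is called an inversion of $\sigma$; $N(\sigma)$ denotes the set of inversions of $\sigma$. Let $D=\{(i,j)\mid 1\le j<i\le n\}$. A subset $Y\subset S_n$ is inversion complete if $\bigcup_{\sigma\in Y}N(\sigma)=D$; it is minimal inversion complete if it is inversion complete and no proper subset of $Y$ is inversion complete. *)

theory Defs
  imports "HOL-Combinatorics.Permutations"
begin

text \<open>Permutations of \<open>{1..n}\<close> are the functions \<open>\<sigma>\<close> on \<^typ>\<open>nat\<close> with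
  \<open>\<sigma> permutes {1..n}\<close>; they fix every number outside \<open>{1..n}\<close>, so each element of the
  symmetric group is represented exactly once.\<close>

definition sym_grp :: "nat \<Rightarrow> (nat \<Rightarrow> nat) set" where
  "sym_grp n = {\<sigma>. \<sigma> permutes {1..n}}"

text \<open>Inversions are recorded by values, with the larger value first.\<close>

definition inversions :: "nat \<Rightarrow> (nat \<Rightarrow> nat) \<Rightarrow> (nat \<times> nat) set" where
  "inversions n \<sigma> = {(\<sigma> i, \<sigma> j) | i j. 1 \<le> i \<and> i < j \<and> j \<le> n \<and> \<sigma> i > \<sigma> j}"

definition all_inversions :: "nat \<Rightarrow> (nat \<times> nat) set" where
  "all_inversions n = {(i, j). 1 \<le> j \<and> j < i \<and> i \<le> n}"

definition inversion_complete :: "nat \<Rightarrow> (nat \<Rightarrow> nat) set \<Rightarrow> bool" where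
  "inversion_complete n Y \<longleftrightarrow>
     Y \<subseteq> sym_grp n \<and> (\<Union>\<sigma>\<in>Y. inversions n \<sigma>) = all_inversions n"

definition minimal_inversion_complete :: "nat \<Rightarrow> (nat \<Rightarrow> nat) set \<Rightarrow> bool" where
  "minimal_inversion_complete n Y \<longleftrightarrow>
     inversion_complete n Y \<and> (\<forall>Z. Z \<subset> Y \<longrightarrow> \<not> inversion_complete n Z)"

end

theory Submission imports Defs begin

text \<open>
  In a minimal inversion complete set every permutation owns a private inversion. If \<open>c > b > a\<close>
  and \<open>c\<close> stands before \<open>a\<close>, then \<open>c\<close> stands before \<open>b\<close> or \<open>b\<close> stands before \<open>a\<close>; hence the
  private inversions, one per permutation, are the edges of a triangle-free graph on \<open>{1..n}\<close>, and
  Mantel's theorem bounds their number. For the converse split \<open>{1..n}\<close> into a lower half \<open>L\<close> and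
  an upper half \<open>H\<close>. For \<open>h \<in> H\<close> and \<open>l \<in> L\<close> the word consisting of \<open>L - {l}\<close> in decreasing order,
  then \<open>h\<close>, \<open>l\<close>, and then \<open>H - {h}\<close> in decreasing order has \<open>(h, l)\<close> as its only inversion between
  \<open>H\<close> and \<open>L\<close>, and together these words realise all inversions.
\<close>

section \<open>Mantel's theorem\<close>

text \<open>Induction on the number of vertices, deleting both endpoints of one edge: without
  triangles, each other vertex is joined to at most one of them.\<close>

lemma mantel:
  assumes "finite V" and "\<And>e. e \<in> E \<Longrightarrow> e \<subseteq> V \<and> card e = 2"
    and "\<And>x y z. {x, y} \<in> E \<Longrightarrow> {y, z} \<in> E \<Longrightarrow> {x, z} \<in> E \<Longrightarrow> False"
  shows "card E \<le> (card V)\<^sup>2 div 4"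
  using assms
proof (induction "card V" arbitrary: V E rule: less_induct)
  case less
  note fin = less.prems(1) and edge = less.prems(2) and tri = less.prems(3)
  show ?case
  proof (cases "E = {}")
    case False
    then obtain e where e: "e \<in> E" by blast
    with edge have "card e = 2" by blast
    with e obtain x y where xy: "{x, y} \<in> E" "x \<noteq> y"
      by (auto simp: card_2_iff)
    then have xyV: "x \<in> V" "y \<in> V" using edge by auto
    define W where "W = V - {x, y}"
    \<comment> \<open>\<open>A\<close> lives on \<open>W\<close> and falls to the induction
      hypothesis; \<open>B\<close> consists of the edges with exactly one endpoint in
      \<open>{x, y}\<close>.\<close>
    define A where "A = {e \<in> E. e \<inter> {x, y} = {}}"
    define B where "B = {e \<in> E. e \<inter> {x, y} \<noteq> {} \<and> e \<noteq> {x, y}}"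
    have finE: "finite E"
      using fin edge by (intro finite_subset[of E "Pow V"]) auto
    have cardV: "card V = card W + 2"
      using fin xyV xy(2) card_mono[of V "{x, y}"] by (simp add: W_def card_Diff_subset)
    have "card A \<le> (card W)\<^sup>2 div 4"
    proof (rule less.hyps)
      show "card W < card V" by (simp add: cardV)
      show "finite W" using fin by (simp add: W_def)
      show "e \<subseteq> W \<and> card e = 2" if "e \<in> A" for e
        using edge[of e] that by (auto simp: A_def W_def)
      show False if "{a, b} \<in> A" "{b, c} \<in> A" "{a, c} \<in> A" for a b c
        using tri[of a b c] that by (simp add: A_def)
    qed
    moreover have "card B \<le> card W"
    proof -
      have B_cases: "\<exists>z\<in>W. e - {x, y} = {z} \<and> (e = {x, z} \<or> e = {y, z})" if "e \<in> B" for e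
      proof -
        from that edge[of e] obtain a b where "e = {a, b}" "a \<noteq> b" "{a, b} \<subseteq> V"
          by (auto simp: B_def card_2_iff)
        with that show ?thesis by (auto simp: B_def W_def)
      qed
      \<comment> \<open>The map returns the endpoint \<open>z\<close> in \<open>W\<close>. Two edges
        of \<open>B\<close> sharing it would be \<open>{x, z}\<close> and \<open>{y, z}\<close>, a
        triangle with \<open>{x, y}\<close>.\<close>
      have "inj_on (\<lambda>e. e - {x, y}) B"
      proof (rule inj_onI)
        fix e f assume ef: "e \<in> B" "f \<in> B" "e - {x, y} = f - {x, y}"
        then obtain z where z: "e = {x, z} \<or> e = {y, z}" "f = {x, z} \<or> f = {y, z}"
          using B_cases[OF ef(1)] B_cases[OF ef(2)] by (metis singleton_inject)
        have "e \<in> E" "f \<in> E" using ef by (auto simp: B_def)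
        with z tri[OF xy(1), of z] show "e = f" by metis
      qed
      moreover have "(\<lambda>e. e - {x, y}) ` B \<subseteq> (\<lambda>z. {z}) ` W"
        using B_cases by (intro image_subsetI) (metis imageI)
      moreover have "finite W" using fin by (simp add: W_def)
      ultimately have "card B \<le> card ((\<lambda>z. {z}) ` W)"
        by (intro card_inj_on_le) auto
      with \<open>finite W\<close> show ?thesis
        using card_image_le[of W "\<lambda>z. {z}"] by linarith
    qed
    moreover have "card E \<le> card A + card B + 1"
    proof -
      have "E = insert {x, y} (A \<union> B)" using xy by (auto simp: A_def B_def)
      then have "card E \<le> Suc (card (A \<union> B))"
        by (metis card_insert_if finE finite_insert le_SucI order_refl)
      with card_Un_le[of A B] show ?thesis by linarith
    qed
    moreover have "(card V)\<^sup>2 div 4 = (card W)\<^sup>2 div 4 + card W + 1"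
    proof -
      have "(card V)\<^sup>2 = (card W)\<^sup>2 + (card W + 1) * 4"
        by (simp add: cardV power2_eq_square algebra_simps)
      then show ?thesis by simp
    qed
    ultimately show ?thesis by linarith
  qed simp
qed

section \<open>Inversions and minimality\<close>

text \<open>\<open>inv \<sigma> v\<close> is the position of the value \<open>v\<close>, so
  inversions become comparisons of positions.\<close>

lemma inversions_iff:
  assumes "\<sigma> permutes {1..n}"
  shows "(b, a) \<in> inversions n \<sigma> \<longleftrightarrow> (b, a) \<in> all_inversions n \<and> inv \<sigma> b < inv \<sigma> a"
proof
  assume "(b, a) \<in> inversions n \<sigma>"
  then obtain i j where ij: "b = \<sigma> i" "a = \<sigma> j" "1 \<le> i" "i < j" "j \<le> n" "\<sigma> i > \<sigma> j"
    by (auto simp: inversions_def)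
  then have "\<sigma> i \<in> {1..n}" "\<sigma> j \<in> {1..n}"
    unfolding permutes_in_image[OF assms] by simp_all
  then show "(b, a) \<in> all_inversions n \<and> inv \<sigma> b < inv \<sigma> a"
    unfolding ij(1,2) permutes_inverses[OF assms]
    using ij(4,6) by (simp add: all_inversions_def)
next
  assume r: "(b, a) \<in> all_inversions n \<and> inv \<sigma> b < inv \<sigma> a"
  then have "inv \<sigma> b \<in> {1..n}" "inv \<sigma> a \<in> {1..n}"
    unfolding permutes_in_image[OF permutes_inv[OF assms]] by (auto simp: all_inversions_def)
  moreover have "\<sigma> (inv \<sigma> b) = b" "\<sigma> (inv \<sigma> a) = a"
    by (simp_all add: permutes_inverses[OF assms])
  ultimately show "(b, a) \<in> inversions n \<sigma>"
    using r unfolding inversions_def all_inversions_def mem_Collect_eq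
    by (intro exI[of _ "inv \<sigma> b"] exI[of _ "inv \<sigma> a"]) simp
qed

text \<open>A pair missed by \<open>Y - {\<sigma>}\<close> is private to \<open>\<sigma>\<close>;
  conversely, a proper subset loses the private pair of any permutation it omits.\<close>

lemma minimal_inversion_complete_iff:
  "minimal_inversion_complete n Y \<longleftrightarrow> inversion_complete n Y \<and>
     (\<forall>\<sigma>\<in>Y. \<exists>p\<in>inversions n \<sigma>. \<forall>\<tau>\<in>Y - {\<sigma>}. p \<notin> inversions n \<tau>)"
proof (intro iffI conjI ballI)
  assume min: "minimal_inversion_complete n Y"
  then show Y: "inversion_complete n Y" by (simp add: minimal_inversion_complete_def)
  fix \<sigma> assume "\<sigma> \<in> Y"
  with min have "\<not> inversion_complete n (Y - {\<sigma>})"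
    by (auto simp: minimal_inversion_complete_def)
  with Y \<open>\<sigma> \<in> Y\<close> show "\<exists>p\<in>inversions n \<sigma>. \<forall>\<tau>\<in>Y - {\<sigma>}. p \<notin> inversions n \<tau>"
    unfolding inversion_complete_def by blast
next
  assume r: "inversion_complete n Y \<and>
    (\<forall>\<sigma>\<in>Y. \<exists>p\<in>inversions n \<sigma>. \<forall>\<tau>\<in>Y - {\<sigma>}. p \<notin> inversions n \<tau>)"
  have "\<not> inversion_complete n Z" if "Z \<subset> Y" for Z
  proof -
    from that obtain \<sigma> where "\<sigma> \<in> Y" "\<sigma> \<notin> Z" by blast
    with r obtain p where "p \<in> inversions n \<sigma>" "\<forall>\<tau>\<in>Y - {\<sigma>}. p \<notin> inversions n \<tau>" by blast
    moreover from this(1) r \<open>\<sigma> \<in> Y\<close> have "p \<in> all_inversions n"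
      unfolding inversion_complete_def by blast
    ultimately show ?thesis
      using that \<open>\<sigma> \<notin> Z\<close> unfolding inversion_complete_def by blast
  qed
  with r show "minimal_inversion_complete n Y" by (simp add: minimal_inversion_complete_def)
qed

section \<open>The upper bound\<close>

lemma card_minimal_inversion_complete_le:
  assumes "minimal_inversion_complete n Y"
  shows "card Y \<le> n\<^sup>2 div 4"
proof -
  have perm: "\<sigma> permutes {1..n}" if "\<sigma> \<in> Y" for \<sigma>
    using assms that
    by (auto simp: minimal_inversion_complete_def inversion_complete_def sym_grp_def)
  obtain p where p: "p \<sigma> \<in> inversions n \<sigma>" and "\<forall>\<tau>\<in>Y - {\<sigma>}. p \<sigma> \<notin> inversions n \<tau>"
    if "\<sigma> \<in> Y" for \<sigma>
    using assms unfolding minimal_inversion_complete_iff by metis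
  then have priv: "\<tau> = \<sigma>" if "\<sigma> \<in> Y" "\<tau> \<in> Y" "p \<sigma> \<in> inversions n \<tau>" for \<sigma> \<tau>
    using that by blast
  \<comment> \<open>Forgetting the order loses nothing on \<open>all_inversions n\<close>, where the
    larger value always comes first.\<close>
  define edge :: "nat \<times> nat \<Rightarrow> nat set" where "edge = (\<lambda>(b, a). {a, b})"
  define E where "E = edge ` p ` Y"
  have pD: "p ` Y \<subseteq> all_inversions n"
    using p inversions_iff[OF perm] by (metis image_subsetI prod.collapse)
  have edgeD: "edge (b, a) \<in> E \<longleftrightarrow> (b, a) \<in> p ` Y" if "a < b" for a b
  proof
    assume "edge (b, a) \<in> E"
    then obtain d c where "(d, c) \<in> p ` Y" "{a, b} = {c, d}"
      by (auto simp: E_def edge_def)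
    moreover from this(1) pD have "c < d" by (auto simp: all_inversions_def)
    ultimately show "(b, a) \<in> p ` Y" using that by (auto simp: doubleton_eq_iff)
  qed (simp add: E_def)
  have no_triangle: False
    if "(b, a) \<in> p ` Y" "(c, b) \<in> p ` Y" "(c, a) \<in> p ` Y" for a b c
  proof -
    from that obtain \<rho> \<sigma> \<tau> where Y: "\<rho> \<in> Y" "\<sigma> \<in> Y" "\<tau> \<in> Y"
      and eq: "p \<rho> = (b, a)" "p \<sigma> = (c, b)" "p \<tau> = (c, a)"
      by (metis imageE)
    have lt: "(b, a) \<in> all_inversions n" "(c, b) \<in> all_inversions n" using that pD by auto
    have "inv \<tau> c < inv \<tau> a"
      using p[OF Y(3)] by (simp add: eq inversions_iff[OF perm[OF Y(3)]])
    then have "inv \<tau> c < inv \<tau> b \<or> inv \<tau> b < inv \<tau> a" by linarith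
    then have "(c, b) \<in> inversions n \<tau> \<or> (b, a) \<in> inversions n \<tau>"
      using lt by (auto simp: inversions_iff[OF perm[OF Y(3)]])
    \<comment> \<open>The pair found is private to \<open>\<sigma>\<close> or \<open>\<rho>\<close>,
      yet \<open>p \<tau> = (c, a)\<close> differs from both private pairs.\<close>
    then have "\<tau> = \<sigma> \<or> \<tau> = \<rho>" using priv Y eq by metis
    then show False using eq lt by (auto simp: all_inversions_def)
  qed
  have "inj_on edge (all_inversions n)"
    by (auto simp: inj_on_def edge_def all_inversions_def doubleton_eq_iff)
  then have inj: "inj_on edge (p ` Y)" using pD by (rule inj_on_subset)
  have "inj_on p Y" using p priv by (metis inj_onI)
  then have "card Y = card E"
    by (simp add: E_def card_image[OF inj] card_image)
  also have "\<dots> \<le> (card {1..n})\<^sup>2 div 4"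
  proof (rule mantel)
    show verts: "e \<subseteq> {1..n} \<and> card e = 2" if "e \<in> E" for e
    proof -
      from that obtain b a where "e = {a, b}" "(b, a) \<in> p ` Y"
        by (auto simp: E_def edge_def)
      moreover from this(2) pD have "(b, a) \<in> all_inversions n" by blast
      ultimately show ?thesis by (auto simp: all_inversions_def)
    qed
    show False if xyz: "{x, y} \<in> E" "{y, z} \<in> E" "{x, z} \<in> E" for x y z
    proof -
      \<comment> \<open>Sorting each edge reduces a triangle to \<open>no_triangle\<close> for one
        of the six orders of its vertices.\<close>
      have sym: "{a, b} \<in> E \<longleftrightarrow> (max a b, min a b) \<in> p ` Y" if "a \<noteq> b" for a b
        using edgeD[of "min a b" "max a b"] that
        by (auto simp: edge_def min_def max_def insert_commute)
      have "x \<noteq> y" "y \<noteq> z" "x \<noteq> z"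
        using verts[OF xyz(1)] verts[OF xyz(2)] verts[OF xyz(3)] by auto
      then have "(max x y, min x y) \<in> p ` Y" "(max y z, min y z) \<in> p ` Y"
        "(max x z, min x z) \<in> p ` Y"
        using xyz sym by blast+
      then show False
        using \<open>x \<noteq> y\<close> \<open>y \<noteq> z\<close> \<open>x \<noteq> z\<close> no_triangle[of x y z] no_triangle[of x z y]
          no_triangle[of y x z] no_triangle[of y z x] no_triangle[of z x y] no_triangle[of z y x]
        by (simp add: max_def min_def split: if_splits)
    qed
  qed simp
  finally show ?thesis by simp
qed

section \<open>The extremal family\<close>

text \<open>The position of the value \<open>v\<close> in the word for \<open>(h, l)\<close>, where \<open>L = {1..m}\<close>.\<close>

definition split_pos :: "nat \<Rightarrow> nat \<Rightarrow> nat \<times> nat \<Rightarrow> nat \<Rightarrow> nat" where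
  "split_pos m n = (\<lambda>(h, l) v.
     if v \<notin> {1..n} then v
     else if v = h then m
     else if v = l then m + 1
     else if v < l then m - v
     else if v \<le> m then m + 1 - v
     else if v < h then m + n + 1 - v
     else m + n + 2 - v)"

text \<open>The inverse is taken because \<open>split_pos\<close> sends values to positions, whereas
  a word sends positions to values.\<close>

definition split_perm :: "nat \<Rightarrow> nat \<Rightarrow> nat \<times> nat \<Rightarrow> nat \<Rightarrow> nat" where
  "split_perm m n p = inv (split_pos m n p)"

text \<open>Removing \<open>l\<close> and \<open>h\<close> closes the gaps in the two decreasing
  blocks, which fill the positions \<open>1..m-1\<close> and \<open>m+2..n\<close>; \<open>h\<close>
  and \<open>l\<close> take \<open>m\<close> and \<open>m+1\<close>.\<close>

lemma split_pos_permutes: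
  assumes "p \<in> {m+1..n} \<times> {1..m}"
  shows "split_pos m n p permutes {1..n}"
proof (rule bij_imp_permutes)
  obtain h l where [simp]: "p = (h, l)" by (cases p)
  have hl: "h \<in> {m+1..n}" "l \<in> {1..m}" using assms by simp_all
  have "inj_on (split_pos m n p) {1..n}"
    using hl by (intro linorder_inj_onI') (auto simp: split_pos_def)
  moreover have "split_pos m n p ` {1..n} \<subseteq> {1..n}"
    using hl by (auto simp: split_pos_def)
  ultimately show "bij_betw (split_pos m n p) {1..n} {1..n}"
    by (simp add: bij_betw_def endo_inj_surj)
qed (auto simp: split_pos_def split: prod.splits)

lemma split_perm_permutes:
  assumes "p \<in> {m+1..n} \<times> {1..m}"
  shows "split_perm m n p permutes {1..n}"
  unfolding split_perm_def by (rule permutes_inv[OF split_pos_permutes[OF assms]])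

lemma inversions_split_perm_iff:
  assumes "p \<in> {m+1..n} \<times> {1..m}"
  shows "(b, a) \<in> inversions n (split_perm m n p) \<longleftrightarrow>
    (b, a) \<in> all_inversions n \<and> split_pos m n p b < split_pos m n p a"
proof -
  have "inv (split_perm m n p) = split_pos m n p"
    unfolding split_perm_def by (rule permutes_inv_inv[OF split_pos_permutes[OF assms]])
  then show ?thesis by (simp add: inversions_iff[OF split_perm_permutes[OF assms]])
qed

text \<open>Only \<open>h\<close> among the upper values stands before position \<open>m+2\<close>,
  and only \<open>l\<close> among the lower ones stands after position \<open>m\<close>. So
  \<open>p\<close> is private, and it is determined by its permutation.\<close>

lemma cross_inversion_split_perm_iff:
  assumes "p \<in> {m+1..n} \<times> {1..m}" "q \<in> {m+1..n} \<times> {1..m}"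
  shows "q \<in> inversions n (split_perm m n p) \<longleftrightarrow> q = p"
proof -
  obtain h l b a where [simp]: "p = (h, l)" "q = (b, a)" by (cases p, cases q)
  show ?thesis
    using assms
    by (auto simp: inversions_split_perm_iff[OF assms(1), simplified] all_inversions_def
        split_pos_def)
qed

lemma inversion_complete_split_perm:
  assumes "2 \<le> n \<Longrightarrow> 1 \<le> m \<and> m < n"
  shows "inversion_complete n (split_perm m n ` ({m+1..n} \<times> {1..m}))"
  unfolding inversion_complete_def
proof (intro conjI equalityI subsetI)
  fix \<sigma> assume "\<sigma> \<in> split_perm m n ` ({m+1..n} \<times> {1..m})"
  then show "\<sigma> \<in> sym_grp n" using split_perm_permutes by (auto simp: sym_grp_def)
next
  fix q assume "q \<in> (\<Union>\<sigma>\<in>split_perm m n ` ({m+1..n} \<times> {1..m}). inversions n \<sigma>)"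
  then show "q \<in> all_inversions n"
    by (cases q) (auto simp: inversions_split_perm_iff)
next
  fix q assume q: "q \<in> all_inversions n"
  then obtain b a where [simp]: "q = (b, a)" and ba: "1 \<le> a" "a < b" "b \<le> n"
    by (auto simp: all_inversions_def)
  \<comment> \<open>The existence of a pair forces \<open>2 \<le> n\<close>, so both halves are
    nonempty.\<close>
  then have m: "1 \<le> m" "m < n" using assms by auto
  \<comment> \<open>Two values in the same half are inverted once the smaller one is \<open>l\<close> or the larger one is \<open>h\<close>.\<close>
  define p where "p = (if b \<le> m then n else b, if m < a then 1 else a)"
  have p: "p \<in> {m+1..n} \<times> {1..m}" using m ba by (auto simp: p_def)
  have "split_pos m n p b < split_pos m n p a"
    using m ba by (auto simp: p_def split_pos_def)
  with p q show "q \<in> (\<Union>\<sigma>\<in>split_perm m n ` ({m+1..n} \<times> {1..m}). inversions n \<sigma>)"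
    using inversions_split_perm_iff[OF p] by auto
qed

lemma half_times_half: "(n - n div 2) * (n div 2) = n\<^sup>2 div 4" for n :: nat
proof (cases "even n")
  case True
  then show ?thesis by (auto simp: power2_eq_square elim!: evenE)
next
  case False
  then obtain k where n: "n = 2 * k + 1" by (auto elim: oddE)
  then have "n\<^sup>2 = 1 + (k + 1) * k * 4" by (simp add: power2_eq_square algebra_simps)
  then have "n\<^sup>2 div 4 = (k + 1) * k" by simp
  with n show ?thesis by simp
qed

lemma minimal_inversion_complete_split_perm:
  assumes "2 \<le> n \<Longrightarrow> 1 \<le> m \<and> m < n"
  shows "minimal_inversion_complete n (split_perm m n ` ({m+1..n} \<times> {1..m}))"
  unfolding minimal_inversion_complete_iff
proof (intro conjI ballI)
  show "inversion_complete n (split_perm m n ` ({m+1..n} \<times> {1..m}))"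
    by (rule inversion_complete_split_perm) (rule assms)
  fix \<sigma> assume "\<sigma> \<in> split_perm m n ` ({m+1..n} \<times> {1..m})"
  then obtain p where "p \<in> {m+1..n} \<times> {1..m}" "\<sigma> = split_perm m n p" by blast
  then show "\<exists>q\<in>inversions n \<sigma>. \<forall>\<tau>\<in>split_perm m n ` ({m+1..n} \<times> {1..m}) - {\<sigma>}.
      q \<notin> inversions n \<tau>"
    using cross_inversion_split_perm_iff by (intro bexI[of _ p]) blast+
qed

lemma card_split_perm:
  "card (split_perm m n ` ({m+1..n} \<times> {1..m})) = (n - m) * m"
proof -
  have "inj_on (split_perm m n) ({m+1..n} \<times> {1..m})"
    by (rule inj_onI) (metis cross_inversion_split_perm_iff)
  then show ?thesis by (simp add: card_image card_cartesian_product)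
qed

theorem theorem1p1:
  fixes n :: nat
  assumes "n \<ge> 1"
  shows "(\<exists>Y. minimal_inversion_complete n Y \<and> card Y = n\<^sup>2 div 4) \<and>
         (\<forall>Y. minimal_inversion_complete n Y \<longrightarrow> card Y \<le> n\<^sup>2 div 4)"
proof -
  \<comment> \<open>The balanced split maximises \<open>(n - m) * m\<close>; for
    \<open>n = 1\<close> the family is empty.\<close>
  let ?Y = "split_perm (n div 2) n ` ({n div 2 + 1..n} \<times> {1..n div 2})"
  have "minimal_inversion_complete n ?Y"
    by (rule minimal_inversion_complete_split_perm) simp
  moreover have "card ?Y = n\<^sup>2 div 4"
    by (simp only: card_split_perm half_times_half)
  ultimately show ?thesis using card_minimal_inversion_complete_le by blast
qed

end
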